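(* Let $G$ be a connected undirected graph on $n$ vertices, with no loops but possibly multiple edges, and let $|E(G)|$ be its number of edges. Suppose $f$ is any monotonically increasing function such that $\sigma_0(m)\le f(m)$ for all positive integers $m$. Then \[\#A(G) \leq \frac{n!}{2}\, |E(G)|^{2^{n-2} - 1} \cdot f\left(|E(G)|^{2^{n-1}}\right).\]
   Context: $\sigma_0(m)$ denotes the number of positive divisors of $m$. With vertices $v_1,\dots,v_n$ and $\delta_{ij}$ edges between $v_i$ and $v_j$, an arithmetical structure on $G$ is a pair $(\mathbf r,\mathbf d)$ of vectors of positive integers with $\gcd(r_1,\dots,r_n)=1$ and $r_id_i=\sum_{j\ne i}r_j\delta_{ij}$ for all $i$; it is identified with $\mathbf r$. $A(G)$ is the set of arithmetical structures on $G$ (vertices labeled, so order matters). *)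

theory Defs
  imports Complex_Main "HOL-Library.FuncSet"
begin

text \<open>
  A finite undirected multigraph: \<open>ends e\<close> is the set of the two endpoints of the edge \<open>e\<close>.
  Having exactly two endpoints excludes loops, and \<open>ends\<close> need not be injective, so multiple
  edges are allowed.
\<close>

definition loopfree_multigraph :: "'v set \<Rightarrow> 'e set \<Rightarrow> ('e \<Rightarrow> 'v set) \<Rightarrow> bool" where
  "loopfree_multigraph V E ends \<longleftrightarrow>
     finite V \<and> finite E \<and> (\<forall>e\<in>E. ends e \<subseteq> V \<and> card (ends e) = 2)"

definition connected_multigraph :: "'v set \<Rightarrow> 'e set \<Rightarrow> ('e \<Rightarrow> 'v set) \<Rightarrow> bool" where
  "connected_multigraph V E ends \<longleftrightarrow>
     V \<noteq> {} \<and> (\<forall>u\<in>V. \<forall>v\<in>V. (u, v) \<in> {(x, y). \<exists>e\<in>E. ends e = {x, y}}\<^sup>*)"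

definition edge_mult :: "'e set \<Rightarrow> ('e \<Rightarrow> 'v set) \<Rightarrow> 'v \<Rightarrow> 'v \<Rightarrow> nat" where
  "edge_mult E ends u v = card {e \<in> E. ends e = {u, v}}"

text \<open>
  Vectors indexed by the vertices are functions in \<open>V \<rightarrow>\<^sub>E {1..}\<close>; extensionality makes each
  structure be counted once.
\<close>

definition arithmetical_structures ::
    "'v set \<Rightarrow> 'e set \<Rightarrow> ('e \<Rightarrow> 'v set) \<Rightarrow> (('v \<Rightarrow> nat) \<times> ('v \<Rightarrow> nat)) set" where
  "arithmetical_structures V E ends =
     {(r, d). r \<in> V \<rightarrow>\<^sub>E {1..} \<and> d \<in> V \<rightarrow>\<^sub>E {1..} \<and> Gcd (r ` V) = 1 \<and>
        (\<forall>i\<in>V. r i * d i = (\<Sum>j\<in>V - {i}. r j * edge_mult E ends i j))}"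

definition sigma0 :: "nat \<Rightarrow> nat" where
  "sigma0 m = card {k. k dvd m}"

end

theory Submission
  imports Defs
begin

text \<open>
  Induction on \<open>n\<close> by eliminating a vertex \<open>v\<close> at which \<open>r\<close> is maximal; there
  \<open>d\<^sub>v \<le> deg v \<le> |E|\<close>. Substituting \<open>r\<^sub>v = (\<Sum>j. r\<^sub>j \<delta>\<^sub>v\<^sub>j) / d\<^sub>v\<close> into the other equations and
  clearing the denominator turns the remaining entries of \<open>r\<close>, divided by their gcd, into a
  structure on \<open>n - 1\<close> vertices for the multiplicities \<open>d\<^sub>v \<delta>\<^sub>i\<^sub>j + \<delta>\<^sub>i\<^sub>v \<delta>\<^sub>j\<^sub>v\<close>, which describe
  a connected graph with at most \<open>|E|\<^sup>2\<close> edges. Since \<open>r\<close> is recovered from \<open>v\<close>, \<open>d\<^sub>v\<close> and the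
  smaller structure, there are at most \<open>n |E|\<close> times as many structures as on a graph with
  \<open>n - 1\<close> vertices and \<open>|E|\<^sup>2\<close> edges. For \<open>n = 2\<close> and \<open>w\<close> edges, structures are coprime pairs
  of divisors of \<open>w\<close>, and these correspond to divisors of \<open>w\<^sup>2\<close>.
\<close>

section \<open>Structures for multiplicity functions, and elimination of a vertex\<close>

text \<open>Since all \<open>r i\<close> are positive, \<open>d\<close> is determined by
  \<open>r\<close>, so it is replaced by a divisibility condition. Multiplicities \<open>w\<close>
  take the place of edges, so that elimination is plain arithmetic. Sums omit \<open>j = i\<close>,
  so nonzero diagonal values of \<open>w\<close>, which elimination creates, are harmless.\<close>

definition arith_vectors :: "'v set \<Rightarrow> ('v \<Rightarrow> 'v \<Rightarrow> nat) \<Rightarrow> ('v \<Rightarrow> nat) set" where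
  "arith_vectors V w = {r \<in> V \<rightarrow>\<^sub>E {1..}. Gcd (r ` V) = 1 \<and>
     (\<forall>i\<in>V. r i dvd (\<Sum>j\<in>V - {i}. r j * w i j))}"

text \<open>Connectedness in terms of cuts rather than paths, which is easier to carry through an
  elimination.\<close>

definition cut_connected :: "'v set \<Rightarrow> ('v \<Rightarrow> 'v \<Rightarrow> nat) \<Rightarrow> bool" where
  "cut_connected V w \<longleftrightarrow>
     (\<forall>S. S \<subseteq> V \<longrightarrow> S \<noteq> {} \<longrightarrow> S \<noteq> V \<longrightarrow> (\<exists>i\<in>S. \<exists>j\<in>V - S. 0 < w i j))"

text \<open>For symmetric \<open>w\<close>, these are off the diagonal, up to sign, \<open>d\<close>
  times the entries of the Schur complement of the matrix with diagonal entry \<open>d\<close> at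
  \<open>v\<close> and off-diagonal entries \<open>- w i j\<close>.\<close>

definition eliminate :: "('v \<Rightarrow> 'v \<Rightarrow> nat) \<Rightarrow> 'v \<Rightarrow> nat \<Rightarrow> 'v \<Rightarrow> 'v \<Rightarrow> nat" where
  "eliminate w v d = (\<lambda>i j. d * w i j + w i v * w j v)"

lemma cut_connectedE:
  assumes "cut_connected V w" "S \<subseteq> V" "S \<noteq> {}" "S \<noteq> V"
  obtains i j where "i \<in> S" "j \<in> V - S" "0 < w i j"
  using assms unfolding cut_connected_def by blast

lemma eliminate_commute:
  assumes "\<And>i j. w i j = w j i"
  shows "eliminate w v d i j = eliminate w v d j i"
  using assms[of i j] by (simp add: eliminate_def mult.commute)

text \<open>Apply the cut condition to \<open>S\<close> and to \<open>insert v S\<close>. An edge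
  found that avoids \<open>v\<close> survives because \<open>0 < d\<close>. Otherwise
  \<open>v\<close> has a neighbour in \<open>S\<close> and one outside, and the product term joins
  these two.\<close>

lemma cut_connected_eliminate:
  assumes "cut_connected V w" "\<And>i j. w i j = w j i" "v \<in> V" "0 < d"
  shows "cut_connected (V - {v}) (eliminate w v d)"
  unfolding cut_connected_def
proof (intro allI impI)
  fix S assume S: "S \<subseteq> V - {v}" "S \<noteq> {}" "S \<noteq> V - {v}"
  obtain i j where ij: "i \<in> S" "j \<in> V - S" "0 < w i j"
    using cut_connectedE[OF assms(1), of S] S assms(3) by blast
  obtain k l where kl: "k \<in> insert v S" "l \<in> V - insert v S" "0 < w k l"
    using cut_connectedE[OF assms(1), of "insert v S"] S assms(3) by blast
  show "\<exists>i\<in>S. \<exists>j\<in>V - {v} - S. 0 < eliminate w v d i j"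
  proof (cases "j \<noteq> v")
    case True
    then show ?thesis using ij assms(4)
      by (intro bexI[of _ i] bexI[of _ j]) (auto simp: eliminate_def)
  next
    case jv: False
    show ?thesis
    proof (cases "k = v")
      case True
      then show ?thesis using ij kl jv assms(2)[of v l]
        by (intro bexI[of _ i] bexI[of _ l]) (auto simp: eliminate_def)
    next
      case False
      then show ?thesis using kl assms(4)
        by (intro bexI[of _ k] bexI[of _ l]) (auto simp: eliminate_def)
    qed
  qed
qed

section \<open>Growth of the number of edges\<close>

lemma sum_multiplicities_remove:
  fixes w :: "'v \<Rightarrow> 'v \<Rightarrow> nat"
  assumes "finite V" "v \<in> V" "\<And>i j. w i j = w j i"
  shows "(\<Sum>i\<in>V. \<Sum>j\<in>V - {i}. w i j)
    = (\<Sum>i\<in>V - {v}. \<Sum>j\<in>V - {v} - {i}. w i j) + 2 * (\<Sum>j\<in>V - {v}. w v j)"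
proof -
  have "(\<Sum>j\<in>V - {i}. w i j) = w v i + (\<Sum>j\<in>V - {v} - {i}. w i j)" if "i \<in> V - {v}" for i
  proof -
    have "(\<Sum>j\<in>V - {i}. w i j) = w i v + (\<Sum>j\<in>V - {i} - {v}. w i j)"
      using that assms by (intro sum.remove) auto
    moreover have "V - {i} - {v} = V - {v} - {i}" by blast
    ultimately show ?thesis by (simp add: assms(3)[of v i])
  qed
  then have "(\<Sum>i\<in>V - {v}. \<Sum>j\<in>V - {i}. w i j)
    = (\<Sum>j\<in>V - {v}. w v j) + (\<Sum>i\<in>V - {v}. \<Sum>j\<in>V - {v} - {i}. w i j)"
    by (simp add: sum.distrib)
  then show ?thesis
    using sum.remove[OF assms(1,2), of "\<lambda>i. \<Sum>j\<in>V - {i}. w i j"] by simp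
qed

text \<open>Ordered pairs count every edge twice, hence the factors 2. With \<open>D\<close> the
  degree of \<open>v\<close> and \<open>T\<close> the total over the other vertices,
  \<open>T + 2 * D \<le> 2 * m\<close> gives \<open>D \<le> m\<close>, so the new total is at most
  \<open>d * T + D * D \<le> m * (T + 2 * D)\<close>.\<close>

lemma sum_multiplicities_eliminate_le:
  fixes w :: "'v \<Rightarrow> 'v \<Rightarrow> nat"
  assumes "finite V" "v \<in> V" "\<And>i j. w i j = w j i"
    and "(\<Sum>i\<in>V. \<Sum>j\<in>V - {i}. w i j) \<le> 2 * m" "d \<le> m"
  shows "(\<Sum>i\<in>V - {v}. \<Sum>j\<in>V - {v} - {i}. eliminate w v d i j) \<le> 2 * m\<^sup>2"
proof -
  define T where "T = (\<Sum>i\<in>V - {v}. \<Sum>j\<in>V - {v} - {i}. w i j)"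
  define D where "D = (\<Sum>j\<in>V - {v}. w v j)"
  have TD: "T + 2 * D \<le> 2 * m"
    using sum_multiplicities_remove[of V v w, OF assms(1-3)] assms(4) unfolding T_def D_def by simp
  have "(\<Sum>i\<in>V - {v}. \<Sum>j\<in>V - {v} - {i}. eliminate w v d i j)
    = d * T + (\<Sum>i\<in>V - {v}. \<Sum>j\<in>V - {v} - {i}. w i v * w j v)"
    by (simp add: eliminate_def T_def sum.distrib sum_distrib_left)
  \<comment> \<open>Adding the diagonal terms makes the double sum a product.\<close>
  also have "(\<Sum>i\<in>V - {v}. \<Sum>j\<in>V - {v} - {i}. w i v * w j v)
      \<le> (\<Sum>i\<in>V - {v}. \<Sum>j\<in>V - {v}. w i v * w j v)"
    using assms(1) by (intro sum_mono sum_mono2) auto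
  also have "\<dots> = D * D"
    using assms(3)[of _ v] by (simp add: D_def sum_product)
  also have "d * T \<le> m * T" using assms(5) by simp
  also have "D * D \<le> m * (2 * D)" using TD by (simp add: mult_mono)
  also have "m * T + m * (2 * D) \<le> m * (2 * m)"
    using mult_le_mono2[OF TD, of m] by (simp only: distrib_left)
  finally show ?thesis by (simp add: power2_eq_square)
qed

section \<open>Effect of elimination on structures\<close>

text \<open>Multiply the sum at \<open>i\<close> by \<open>d\<close> and substitute for
  \<open>r v * d\<close>. The extra term on the left is the loop that this creates at
  \<open>i\<close>; being a multiple of \<open>r i\<close>, it does not affect divisibility by
  \<open>r i\<close>.\<close>

lemma sum_eliminate:
  fixes r :: "'v \<Rightarrow> nat"
  assumes "finite V" "v \<in> V" "i \<in> V" "i \<noteq> v" "\<And>i j. w i j = w j i"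
    and "r v * d = (\<Sum>j\<in>V - {v}. r j * w v j)"
  shows "(\<Sum>j\<in>V - {v} - {i}. r j * eliminate w v d i j) + r i * (w i v * w i v)
    = d * (\<Sum>j\<in>V - {i}. r j * w i j)"
proof -
  define A where "A = (\<Sum>j\<in>V - {v} - {i}. r j * w i j)"
  define B where "B = (\<Sum>j\<in>V - {v} - {i}. r j * w j v)"
  have "(\<Sum>j\<in>V - {i}. r j * w i j) = r v * w i v + (\<Sum>j\<in>V - {i} - {v}. r j * w i j)"
    using assms by (intro sum.remove) auto
  moreover have "V - {i} - {v} = V - {v} - {i}" by blast
  ultimately have 1: "(\<Sum>j\<in>V - {i}. r j * w i j) = r v * w i v + A"
    by (simp add: A_def)
  have "(\<Sum>j\<in>V - {v}. r j * w v j) = r i * w v i + (\<Sum>j\<in>V - {v} - {i}. r j * w v j)"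
    using assms by (intro sum.remove) auto
  then have 2: "r v * d = r i * w i v + B"
    using assms(5)[of v] assms(6) by (simp add: B_def)
  have "(\<Sum>j\<in>V - {v} - {i}. r j * eliminate w v d i j) = d * A + w i v * B"
    by (simp add: eliminate_def A_def B_def sum.distrib sum_distrib_left algebra_simps)
  then have "(\<Sum>j\<in>V - {v} - {i}. r j * eliminate w v d i j) + r i * (w i v * w i v)
      = d * A + w i v * (r i * w i v + B)"
    by (simp add: algebra_simps)
  also have "\<dots> = d * (r v * w i v + A)"
    unfolding 2[symmetric] by (simp add: algebra_simps)
  finally show ?thesis unfolding 1 .
qed

text \<open>By \<open>sum_eliminate\<close>, \<open>r i\<close> divides the new sum at
  \<open>i\<close>. Both sides of this divisibility carry the factor \<open>g\<close>, which
  cancels, and division by \<open>g\<close> makes the gcd 1.\<close>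

lemma arith_vectors_eliminate:
  fixes r :: "'v \<Rightarrow> nat"
  assumes "finite V" "v \<in> V" "V \<noteq> {v}" "\<And>i j. w i j = w j i"
    and r: "r \<in> arith_vectors V w"
    and d: "r v * d = (\<Sum>j\<in>V - {v}. r j * w v j)"
  shows "restrict (\<lambda>i. r i div Gcd (r ` (V - {v}))) (V - {v})
    \<in> arith_vectors (V - {v}) (eliminate w v d)"
proof -
  let ?U = "V - {v}"
  define g where "g = Gcd (r ` ?U)"
  define s where "s = restrict (\<lambda>i. r i div g) ?U"
  have rpos: "0 < r i" if "i \<in> V" for i
    using r that unfolding arith_vectors_def PiE_def Pi_def by fastforce
  obtain u where u: "u \<in> ?U" using assms(2,3) by blast
  have gdvd: "g dvd r i" if "i \<in> ?U" for i
    unfolding g_def using that by (intro Gcd_dvd) auto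
  have gpos: "0 < g" using gdvd[OF u] rpos[of u] u by (auto intro: Nat.gr0I)
  have gs: "g * s i = r i" if "i \<in> ?U" for i
    using gdvd that by (simp add: s_def)
  have spos: "0 < s i" if "i \<in> ?U" for i
    using gs[OF that] rpos[of i] that by (auto intro: Nat.gr0I)
  have "r ` ?U = (*) g ` (s ` ?U)"
    unfolding image_image by (intro image_cong) (simp_all add: gs)
  then have "g = g * Gcd (s ` ?U)"
    using Gcd_mult[of g "s ` ?U"] by (simp add: g_def)
  then have "Gcd (s ` ?U) = 1" using gpos by simp
  moreover have "s i dvd (\<Sum>j\<in>?U - {i}. s j * eliminate w v d i j)" if i: "i \<in> ?U" for i
  proof -
    have "r i dvd (\<Sum>j\<in>V - {i}. r j * w i j)"
      using r i unfolding arith_vectors_def by blast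
    then have "r i dvd (\<Sum>j\<in>?U - {i}. r j * eliminate w v d i j) + r i * (w i v * w i v)"
      using sum_eliminate[OF assms(1,2) _ _ assms(4) d, of i] i by simp
    then have "r i dvd (\<Sum>j\<in>?U - {i}. r j * eliminate w v d i j)"
      using dvd_add_left_iff dvd_triv_left by blast
    also have "(\<Sum>j\<in>?U - {i}. r j * eliminate w v d i j)
        = g * (\<Sum>j\<in>?U - {i}. s j * eliminate w v d i j)"
      unfolding sum_distrib_left
      by (rule sum.cong) (auto simp: gs mult.assoc[symmetric])
    finally show ?thesis using gs[OF i, symmetric] gpos by simp
  qed
  moreover have "s \<in> ?U \<rightarrow>\<^sub>E {1..}"
    using spos by (auto simp: s_def Suc_le_eq)
  ultimately show ?thesis
    unfolding arith_vectors_def s_def g_def by blast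
qed

text \<open>Proportional vectors of gcd 1 agree: taking gcds on both sides gives
  \<open>h = g\<close>.\<close>

lemma arith_vectors_eqI:
  fixes r s :: "'v \<Rightarrow> nat"
  assumes r: "r \<in> arith_vectors V w" and s: "s \<in> arith_vectors V w"
    and eq: "\<And>i. i \<in> V \<Longrightarrow> h * r i = g * s i" and pos: "0 < h"
  shows "r = s"
proof -
  have "(*) h ` (r ` V) = (*) g ` (s ` V)"
    unfolding image_image by (intro image_cong) (simp_all add: eq)
  then have "h * Gcd (r ` V) = g * Gcd (s ` V)"
    using Gcd_mult[of h "r ` V"] Gcd_mult[of g "s ` V"] by simp
  then have "h = g" using r s by (simp add: arith_vectors_def)
  with eq pos have "r i = s i" if "i \<in> V" for i using that by fastforce
  then show ?thesis
    using r s unfolding arith_vectors_def by (auto intro: PiE_ext)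
qed

text \<open>Equal reduced vectors make \<open>r\<close> and \<open>s\<close> proportional away from
  \<open>v\<close>. The equation at \<open>v\<close>, with the same \<open>d\<close> for both,
  extends the proportionality to \<open>v\<close>.\<close>

lemma arith_vectors_eliminate_inj:
  fixes r s :: "'v \<Rightarrow> nat"
  assumes "finite V" "v \<in> V" "V \<noteq> {v}" "0 < d"
    and r: "r \<in> arith_vectors V w" "r v * d = (\<Sum>j\<in>V - {v}. r j * w v j)"
    and s: "s \<in> arith_vectors V w" "s v * d = (\<Sum>j\<in>V - {v}. s j * w v j)"
    and eq: "restrict (\<lambda>i. r i div Gcd (r ` (V - {v}))) (V - {v})
      = restrict (\<lambda>i. s i div Gcd (s ` (V - {v}))) (V - {v})"
  shows "r = s"
proof -
  let ?U = "V - {v}"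
  define g where "g = Gcd (r ` ?U)"
  define h where "h = Gcd (s ` ?U)"
  obtain u where u: "u \<in> ?U" using assms(2,3) by blast
  have "0 < s u" using s u unfolding arith_vectors_def PiE_def Pi_def by fastforce
  moreover have "h dvd s u" unfolding h_def using u by (intro Gcd_dvd) auto
  ultimately have hpos: "0 < h" by (auto intro: Nat.gr0I)
  have U: "h * r i = g * s i" if i: "i \<in> ?U" for i
  proof -
    have "r i div g = s i div h"
      using fun_cong[OF eq, of i] i by (simp add: g_def h_def)
    moreover have "g dvd r i" "h dvd s i"
      unfolding g_def h_def using i by (auto intro: Gcd_dvd)
    ultimately show ?thesis
      by (metis dvd_mult_div_cancel mult.left_commute)
  qed
  have "d * (h * r v) = h * (\<Sum>j\<in>?U. r j * w v j)"
    using r(2) by (simp add: mult.left_commute mult.commute)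
  also have "\<dots> = g * (\<Sum>j\<in>?U. s j * w v j)"
    unfolding sum_distrib_left
    by (rule sum.cong) (simp_all add: U mult.assoc[symmetric])
  also have "\<dots> = d * (g * s v)"
    using s(2) by (simp add: mult.left_commute mult.commute)
  finally have "h * r v = g * s v" using assms(4) by simp
  with U have "h * r i = g * s i" if "i \<in> V" for i
    using that by (cases "i = v") auto
  then show ?thesis by (rule arith_vectors_eqI[OF r(1) s(1) _ hpos])
qed

section \<open>A vertex with a small value of \<open>d\<close>\<close>

text \<open>At a maximal entry \<open>r v\<close>, the sum is at most \<open>r v\<close> times the
  degree of \<open>v\<close>, and the degree is counted twice in the total. A neighbour of
  \<open>v\<close> exists by the cut \<open>{v}\<close>, so \<open>d\<close> is positive.\<close>

lemma arith_vectors_max_vertex: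
  fixes r :: "'v \<Rightarrow> nat"
  assumes "finite V" "2 \<le> card V" "cut_connected V w" "\<And>i j. w i j = w j i"
    and "(\<Sum>i\<in>V. \<Sum>j\<in>V - {i}. w i j) \<le> 2 * m"
    and r: "r \<in> arith_vectors V w"
  obtains v d where "v \<in> V" "d \<in> {1..m}" "r v * d = (\<Sum>j\<in>V - {v}. r j * w v j)"
proof -
  have rpos: "0 < r i" if "i \<in> V" for i
    using r that unfolding arith_vectors_def PiE_def Pi_def by fastforce
  have "V \<noteq> {}" using assms(2) by auto
  then have "Max (r ` V) \<in> r ` V" using assms(1) by (intro Max_in) auto
  then obtain v where v: "v \<in> V" "r v = Max (r ` V)" by force
  then have v_max: "r i \<le> r v" if "i \<in> V" for i using assms(1) that by simp
  obtain d where d: "(\<Sum>j\<in>V - {v}. r j * w v j) = r v * d"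
    using r v(1) unfolding arith_vectors_def dvd_def by blast
  have "V \<noteq> {v}" using assms(2) by auto
  then obtain j where j: "j \<in> V - {v}" "0 < w v j"
    using cut_connectedE[OF assms(3), of "{v}"] v(1) by auto
  have "0 < r j * w v j" using j rpos by simp
  also have "\<dots> \<le> r v * d"
    unfolding d[symmetric] using assms(1) j by (intro member_le_sum) auto
  finally have "1 \<le> d" by (auto intro: Suc_leI Nat.gr0I)
  moreover have "r v * d \<le> r v * (\<Sum>j\<in>V - {v}. w v j)"
    unfolding d[symmetric] sum_distrib_left using v_max by (intro sum_mono mult_right_mono) auto
  then have "d \<le> (\<Sum>j\<in>V - {v}. w v j)" using rpos[OF v(1)] by simp
  then have "d \<le> m"
    using sum_multiplicities_remove[of V v w, OF assms(1) v(1) assms(4)] assms(5) by linarith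
  ultimately show thesis using that v(1) d by simp
qed

section \<open>Two vertices\<close>

lemma card_arith_vectors_two:
  fixes w :: "'v \<Rightarrow> 'v \<Rightarrow> nat"
  assumes "a \<noteq> b" "w a b = w b a" "0 < w a b"
  shows "finite (arith_vectors {a, b} w)"
    and "card (arith_vectors {a, b} w) \<le> sigma0 ((w a b)\<^sup>2)"
proof -
  define W where "W = w a b"
  have Wpos: "0 < W" using assms(3) by (simp add: W_def)
  \<comment> \<open>This is \<open>W\<close> times the fraction \<open>r a / r b\<close>, which is
    in lowest terms and so determines the pair. Both factors divide \<open>W\<close>, so the value
    divides \<open>W\<close> squared.\<close>
  define \<phi> where "\<phi> r = r a * (W div r b)" for r :: "'v \<Rightarrow> nat"
  have R: "coprime (r a) (r b) \<and> 0 < r a \<and> 0 < r b \<and> r a dvd W \<and> r b dvd W"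
    if "r \<in> arith_vectors {a, b} w" for r
  proof -
    have "{a, b} - {a} = {b}" "{a, b} - {b} = {a}" using assms(1) by auto
    then have "r a dvd r b * W" "r b dvd r a * W" and c: "coprime (r a) (r b)"
      and p: "0 < r a" "0 < r b"
      using that assms(2) unfolding arith_vectors_def
      by (auto simp: W_def coprime_iff_gcd_eq_1 PiE_def Pi_def Suc_le_eq)
    then show ?thesis
      by (simp add: coprime_dvd_mult_right_iff coprime_commute)
  qed
  have inj: "inj_on \<phi> (arith_vectors {a, b} w)"
  proof (rule inj_onI)
    fix r s assume r: "r \<in> arith_vectors {a, b} w" and s: "s \<in> arith_vectors {a, b} w"
      and eq: "\<phi> r = \<phi> s"
    note R1 = R[OF r] and R2 = R[OF s]
    have "(s b * r a) * W = s b * r b * \<phi> r"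
      using R1 by (simp add: \<phi>_def mult.commute mult.left_commute)
    also have "\<dots> = (r b * s a) * W"
      unfolding eq using R2 by (simp add: \<phi>_def mult.commute mult.left_commute)
    finally have "s b * r a = r b * s a" using Wpos by simp
    then show "r = s"
      using R2 by (intro arith_vectors_eqI[OF r s, of "s b" "r b"]) auto
  qed
  have sub: "\<phi> ` arith_vectors {a, b} w \<subseteq> {k. k dvd W\<^sup>2}"
  proof clarify
    fix r assume "r \<in> arith_vectors {a, b} w"
    with R have "r a dvd W" "r b dvd W" by auto
    then show "\<phi> r dvd W\<^sup>2"
      unfolding \<phi>_def power2_eq_square by (intro mult_dvd_mono) auto
  qed
  have fin: "finite {k. k dvd W\<^sup>2}" using Wpos by (simp add: finite_divisors_nat)
  show "finite (arith_vectors {a, b} w)"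
    using inj_on_finite[OF inj sub fin] .
  show "card (arith_vectors {a, b} w) \<le> sigma0 ((w a b)\<^sup>2)"
    using card_inj_on_le[OF inj sub fin] by (simp add: sigma0_def W_def)
qed

section \<open>The induction on the number of vertices\<close>

text \<open>Here \<open>k\<close> is the number of vertices minus 2, and \<open>m\<close> bounds the
  number of edges. The induction generalizes \<open>w\<close> and \<open>m\<close>, as elimination
  changes the multiplicities and squares \<open>m\<close>. Finiteness is carried along because
  cardinalities are compared through injections into finite sets.\<close>

lemma card_arith_vectors_le:
  fixes w :: "'v \<Rightarrow> 'v \<Rightarrow> nat" and f :: "nat \<Rightarrow> real"
  assumes mono: "mono_on {1..} f"
    and sig: "\<And>m. m \<ge> 1 \<Longrightarrow> real (sigma0 m) \<le> f m"
    and "finite V" "card V = k + 2" "cut_connected V w" "\<And>i j. w i j = w j i"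
    and "(\<Sum>i\<in>V. \<Sum>j\<in>V - {i}. w i j) \<le> 2 * m"
  shows "finite (arith_vectors V w) \<and>
    real (card (arith_vectors V w)) \<le> fact (k + 2) / 2 * real m ^ (2 ^ k - 1) * f (m ^ 2 ^ (k + 1))"
  using assms(3-7)
proof (induction k arbitrary: V w m)
  case 0
  then obtain a b where V: "V = {a, b}" "a \<noteq> b"
    by (metis add_0 card_2_iff)
  have "0 < w a b"
    using cut_connectedE[OF 0(3), of "{a}"] V by auto
  moreover have "{a, b} - {a} = {b}" "{a, b} - {b} = {a}" using V by auto
  then have "w a b \<le> m" using 0(5) 0(4)[of a b] V by simp
  ultimately have "f ((w a b)\<^sup>2) \<le> f (m\<^sup>2)" "1 \<le> (w a b)\<^sup>2"
    by (auto intro!: mono_onD[OF mono] power_mono simp: Suc_le_eq)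
  moreover have "real (sigma0 ((w a b)\<^sup>2)) \<le> f ((w a b)\<^sup>2)"
    using calculation(2) by (rule sig)
  moreover note card_arith_vectors_two[of a b w, OF V(2) 0(4) \<open>0 < w a b\<close>]
  ultimately show ?case unfolding V by simp
next
  case (Suc k)
  define P where "P = V \<times> {1..m}"
  define R where "R = (\<lambda>(v, d). arith_vectors (V - {v}) (eliminate w v d))"
  define B where "B = fact (k + 2) / 2 * real (m\<^sup>2) ^ (2 ^ k - 1) * f ((m\<^sup>2) ^ 2 ^ (k + 1))"
  have IH: "finite (R p) \<and> real (card (R p)) \<le> B" if pP: "p \<in> P" for p
  proof -
    obtain v d where p: "p = (v, d)" "v \<in> V" "1 \<le> d" "d \<le> m"
      using pP by (auto simp: P_def)
    show ?thesis unfolding p(1) R_def B_def prod.case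
    proof (rule Suc.IH)
      show "card (V - {v}) = k + 2" using Suc.prems(1,2) p by simp
      show "cut_connected (V - {v}) (eliminate w v d)"
        using p Suc.prems by (intro cut_connected_eliminate) auto
      show "eliminate w v d i j = eliminate w v d j i" for i j
        by (intro eliminate_commute Suc.prems)
      show "(\<Sum>i\<in>V - {v}. \<Sum>j\<in>V - {v} - {i}. eliminate w v d i j) \<le> 2 * m\<^sup>2"
        using p Suc.prems by (intro sum_multiplicities_eliminate_le) auto
    qed (use Suc.prems in simp)
  qed
  \<comment> \<open>Maximality of \<open>r v\<close> only served to find such a pair; from here on
    any pair with the equation at \<open>v\<close> and \<open>d \<le> m\<close> will do.\<close>
  define good where "good r = (\<lambda>(v, d). v \<in> V \<and> d \<in> {1..m} \<and>
    r v * d = (\<Sum>j\<in>V - {v}. r j * w v j))" for r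
  define pick where "pick r = (SOME p. good r p)" for r
  have pick: "good r (pick r)" if r: "r \<in> arith_vectors V w" for r
  proof -
    have "2 \<le> card V" using Suc.prems(2) by simp
    then obtain v d where "v \<in> V" "d \<in> {1..m}" "r v * d = (\<Sum>j\<in>V - {v}. r j * w v j)"
      by (rule arith_vectors_max_vertex[OF Suc.prems(1) _ Suc.prems(3-5) r])
    then have "good r (v, d)" by (simp add: good_def)
    then have "\<exists>p. good r p" ..
    then show ?thesis unfolding pick_def by (rule someI_ex)
  qed
  \<comment> \<open>Recording the chosen pair with the reduced vector makes the map injective into a
    disjoint union of \<open>(k + 3) * m\<close> smaller sets.\<close>
  define \<phi> where "\<phi> r = (pick r, restrict
    (\<lambda>i. r i div Gcd (r ` (V - {fst (pick r)}))) (V - {fst (pick r)}))" for r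
  have V1: "V \<noteq> {v}" for v using Suc.prems(2) by auto
  have inj: "inj_on \<phi> (arith_vectors V w)"
  proof (rule inj_onI)
    fix r s assume r: "r \<in> arith_vectors V w" and s: "s \<in> arith_vectors V w"
      and eq: "\<phi> r = \<phi> s"
    obtain v d where p: "pick r = (v, d)" by fastforce
    then have q: "pick s = (v, d)" using eq by (simp add: \<phi>_def)
    show "r = s"
      using pick[OF r] pick[OF s] eq r s V1 Suc.prems(1) unfolding p q good_def \<phi>_def
      by (intro arith_vectors_eliminate_inj[of V v d r w s]) auto
  qed
  have sub: "\<phi> ` arith_vectors V w \<subseteq> Sigma P R"
  proof (rule image_subsetI)
    fix r assume r: "r \<in> arith_vectors V w"
    obtain v d where p: "pick r = (v, d)" by fastforce
    show "\<phi> r \<in> Sigma P R"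
      using pick[OF r] arith_vectors_eliminate[OF Suc.prems(1) _ V1 Suc.prems(4) r, of v d]
      unfolding \<phi>_def p good_def P_def R_def by simp
  qed
  have finP: "finite P" using Suc.prems(1) by (simp add: P_def)
  have fin: "finite (Sigma P R)" using IH finP by (intro finite_SigmaI) auto
  have "real (card (arith_vectors V w)) \<le> real (card (Sigma P R))"
    using card_inj_on_le[OF inj sub fin] by simp
  also have "\<dots> = (\<Sum>p\<in>P. real (card (R p)))"
    using IH finP by (simp add: card_SigmaI)
  also have "\<dots> \<le> (\<Sum>p\<in>P. B)" using IH by (intro sum_mono) auto
  also have "\<dots> = real (k + 3) * real m * B"
    using Suc.prems(2) by (simp add: P_def card_cartesian_product algebra_simps)
  also have "\<dots> = fact (Suc k + 2) / 2 * real m ^ (2 ^ Suc k - 1) * f (m ^ 2 ^ (Suc k + 1))"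
  proof -
    \<comment> \<open>Squaring \<open>m\<close> doubles the exponent and the choice of
      \<open>d\<close> adds one, which is the recursion of \<open>2 ^ k - 1\<close>.\<close>
    have "Suc (2 * (2 ^ k - 1)) = (2 ^ Suc k - 1 :: nat)"
      using one_le_power[of "2::nat" k] unfolding power_Suc by linarith
    then have e1: "real m * real (m\<^sup>2) ^ (2 ^ k - 1) = real m ^ (2 ^ Suc k - 1)"
      by (metis of_nat_power power_Suc power_mult)
    have e2: "(m\<^sup>2) ^ 2 ^ (k + 1) = m ^ 2 ^ (Suc k + 1)"
      by (simp add: power_mult[symmetric])
    have e3: "fact (Suc k + 2) = real (k + 3) * fact (k + 2)"
      by (simp add: algebra_simps)
    show ?thesis
      unfolding B_def e2 e3 e1[symmetric] by (simp only: times_divide_eq_left times_divide_eq_right mult_ac)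
  qed
  finally show ?case using inj_on_finite[OF inj sub fin] by blast
qed

section \<open>From multigraphs to multiplicities\<close>

lemma edge_mult_commute: "edge_mult E ends u v = edge_mult E ends v u"
  by (simp add: edge_mult_def insert_commute)

text \<open>If no edge leaves \<open>S\<close>, a walk starting in \<open>S\<close> stays there, by
  induction along the walk.\<close>

lemma cut_connected_edge_mult:
  assumes "loopfree_multigraph V E ends" "connected_multigraph V E ends"
  shows "cut_connected V (edge_mult E ends)"
  unfolding cut_connected_def
proof (intro allI impI, rule ccontr)
  fix S assume S: "S \<subseteq> V" "S \<noteq> {}" "S \<noteq> V"
    and none: "\<not> (\<exists>i\<in>S. \<exists>j\<in>V - S. 0 < edge_mult E ends i j)"
  obtain u v where uv: "u \<in> S" "v \<in> V - S" using S by blast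
  have "(u, v) \<in> {(x, y). \<exists>e\<in>E. ends e = {x, y}}\<^sup>*"
    using assms(2) uv S(1) unfolding connected_multigraph_def by blast
  then have "v \<in> S"
  proof induction
    case (step y z)
    then obtain e where e: "e \<in> E" "ends e = {y, z}" by blast
    then have "z \<in> V" using assms(1) unfolding loopfree_multigraph_def by blast
    moreover have "0 < edge_mult E ends y z"
      using e assms(1) unfolding edge_mult_def loopfree_multigraph_def
      by (auto simp: card_gt_0_iff)
    ultimately show ?case using none step.IH by blast
  qed (rule uv)
  with uv show False by blast
qed

text \<open>Double counting of pairs and edges: an edge is met only by the two orderings of its
  endpoints.\<close>

lemma sum_edge_mult_le:
  assumes "loopfree_multigraph V E ends"
  shows "(\<Sum>i\<in>V. \<Sum>j\<in>V - {i}. edge_mult E ends i j) \<le> 2 * card E"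
proof -
  have fin: "finite V" "finite E" using assms by (auto simp: loopfree_multigraph_def)
  define D where "D = Sigma V (\<lambda>i. V - {i})"
  have finD: "finite D" using fin by (simp add: D_def)
  have "(\<Sum>i\<in>V. \<Sum>j\<in>V - {i}. edge_mult E ends i j)
      = (\<Sum>p\<in>D. card {e \<in> E. ends e = {fst p, snd p}})"
    using fin by (simp add: D_def edge_mult_def sum.Sigma split_def)
  also have "\<dots> = (\<Sum>p\<in>D. \<Sum>e\<in>E. if ends e = {fst p, snd p} then 1 else 0)"
    using fin by (simp add: sum.If_cases Int_def)
  also have "\<dots> = (\<Sum>e\<in>E. \<Sum>p\<in>D. if ends e = {fst p, snd p} then 1 else 0)"
    by (rule sum.swap)
  also have "\<dots> = (\<Sum>e\<in>E. card {p \<in> D. ends e = {fst p, snd p}})"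
    using finD by (simp add: sum.If_cases Int_def)
  also have "\<dots> \<le> (\<Sum>e\<in>E. 2)"
  proof (rule sum_mono)
    fix e assume "e \<in> E"
    then obtain a b where ab: "ends e = {a, b}"
      using assms unfolding loopfree_multigraph_def by (meson card_2_iff)
    have "{p \<in> D. ends e = {fst p, snd p}} \<subseteq> {(a, b), (b, a)}"
      unfolding ab doubleton_eq_iff by (auto simp: prod_eq_iff)
    then have "card {p \<in> D. ends e = {fst p, snd p}} \<le> card {(a, b), (b, a)}"
      by (intro card_mono) auto
    also have "\<dots> \<le> 2" by (cases "a = b") auto
    finally show "card {p \<in> D. ends e = {fst p, snd p}} \<le> 2" .
  qed
  finally show ?thesis by simp
qed

text \<open>Cancelling \<open>r i \<ge> 1\<close> in the equation at \<open>i\<close> recovers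
  \<open>d i\<close>, so counting structures reduces to counting the vectors
  \<open>r\<close>.\<close>

lemma fst_arithmetical_structures:
  shows "inj_on fst (arithmetical_structures V E ends)"
    and "fst ` arithmetical_structures V E ends \<subseteq> arith_vectors V (edge_mult E ends)"
proof -
  show "inj_on fst (arithmetical_structures V E ends)"
  proof (rule inj_onI, clarsimp)
    fix r d d'
    assume A: "(r, d) \<in> arithmetical_structures V E ends" "(r, d') \<in> arithmetical_structures V E ends"
    have "d i = d' i" if "i \<in> V" for i
    proof -
      have "r i * d i = r i * d' i" "r i \<ge> 1"
        using A that by (auto simp: arithmetical_structures_def)
      then show ?thesis by simp
    qed
    then show "d = d'" using A by (auto simp: arithmetical_structures_def intro: PiE_ext)
  qed
  show "fst ` arithmetical_structures V E ends \<subseteq> arith_vectors V (edge_mult E ends)"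
    unfolding arithmetical_structures_def arith_vectors_def by (fastforce intro: dvdI[OF sym])
qed

theorem theorem3p1:
  fixes V :: "'v set" and E :: "'e set" and ends :: "'e \<Rightarrow> 'v set"
    and n :: nat and f :: "nat \<Rightarrow> real"
  assumes "loopfree_multigraph V E ends"
    and "connected_multigraph V E ends"
    and "card V = n"
    and "n \<ge> 2"
    and "mono_on {1..} f"
    and "\<And>m. m \<ge> 1 \<Longrightarrow> real (sigma0 m) \<le> f m"
  shows "finite (arithmetical_structures V E ends) \<and>
    real (card (arithmetical_structures V E ends))
      \<le> fact n / 2 * real (card E) ^ (2 ^ (n - 2) - 1) * f (card E ^ (2 ^ (n - 1)))"
proof -
  obtain k where n: "n = k + 2" using assms(4) by (metis add.commute le_Suc_ex)
  have "finite V" using assms(1) by (simp add: loopfree_multigraph_def)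
  then have bound: "finite (arith_vectors V (edge_mult E ends)) \<and>
      real (card (arith_vectors V (edge_mult E ends)))
        \<le> fact (k + 2) / 2 * real (card E) ^ (2 ^ k - 1) * f (card E ^ 2 ^ (k + 1))"
    using assms(3) n cut_connected_edge_mult[OF assms(1,2)] sum_edge_mult_le[OF assms(1)]
    by (intro card_arith_vectors_le assms(5,6) edge_mult_commute) auto
  have "finite (arithmetical_structures V E ends)"
    using inj_on_finite[OF fst_arithmetical_structures] bound by blast
  moreover have "card (arithmetical_structures V E ends) \<le> card (arith_vectors V (edge_mult E ends))"
    using card_inj_on_le[OF fst_arithmetical_structures] bound by blast
  ultimately show ?thesis using bound by (simp add: n)
qed

end
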